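(* Let $1<p<\infty$, let $m$ be a positive integer, let $a_1,\dots,a_m$ be real numbers, and let $Q_m:l_p\to l_p$ be the polynomial type operator $Q_m(x)=\left\{\sum_{i=1}^m a_i t_n^i\right\}_{n=1}^\infty$ for $x=\{t_n\}_{n=1}^\infty\in l_p$. Then $Q_m$ is Gâteaux differentiable on $l_p$, and for every $\bar x=\{\bar t_n\}_{n=1}^\infty\in l_p$ the Gâteaux derivative $(Q_m)'(\bar x)$ satisfies: (i) If $m>1$, then $(Q_m)'(\bar x)=\nabla Q_m(\bar x)$ is represented by the infinite diagonal matrix with $n$-th diagonal entry $\sum_{i=1}^m i a_i\bar t_n^{\,i-1}$, i.e. for every $v=\{t_n\}_{n=1}^\infty\in l_p\setminus\{\theta_p\}$, $$(Q_m)'(\bar x)(v)=\nabla Q_m(\bar x)(v)=\left\{\sum_{i=1}^m i a_i\bar t_n^{\,i-1}t_n\right\}_{n=1}^\infty.$$ (ii) If $m=1$, then for every $v=\{t_n\}_{n=1}^\infty\in l_p\setminus\{\theta_p\}$, $$(Q_1)'(\bar x)(v)=\nabla Q_1(\bar x)(v)=a_1v=\{a_1t_n\}_{n=1}^\infty\in l_p.$$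
   Context: $l_p$ is the Banach space of real sequences $x=\{t_n\}_{n=1}^\infty$ with $\|x\|_p=(\sum_n|t_n|^p)^{1/p}<\infty$ and origin $\theta_p$. A map $T:l_p\to l_p$ is Gâteaux differentiable at $\bar x$ if for every $v\in l_p\setminus\{\theta_p\}$ the norm limit $T'(\bar x)(v)=\lim_{t\to0}\frac{T(\bar x+tv)-T(\bar x)}{t}$ ($t$ real) exists. $\nabla T(\bar x)$ denotes the Fréchet derivative: the continuous linear operator with $\lim_{u\to\theta_p}\frac{T(\bar x+u)-T(\bar x)-\nabla T(\bar x)(u)}{\|u\|_p}=\theta_p$. The convention $t^0=1$ (including $0^0=1$) is used. *)

theory Defs
  imports Complex_Main "HOL-Library.FuncSet"
begin

text \<open>
  Since the exponent is a variable of the theorem, $l_p$ is a carrier set of real sequences with an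
  explicit norm rather than a type. Sequences are indexed from 0 instead of 1.
\<close>

definition lp :: "real \<Rightarrow> (nat \<Rightarrow> real) set" where
  "lp p = {x. summable (\<lambda>n. \<bar>x n\<bar> powr p)}"

definition lp_norm :: "real \<Rightarrow> (nat \<Rightarrow> real) \<Rightarrow> real" where
  "lp_norm p x = (\<Sum>n. \<bar>x n\<bar> powr p) powr (1 / p)"

definition lp_zero :: "nat \<Rightarrow> real" where
  "lp_zero = (\<lambda>n. 0)"

text \<open>
  Norm convergence. The membership conditions are needed because \<^const>\<open>lp_norm\<close> is meaningless
  on sequences that are not $p$-summable.
\<close>

definition lp_tendsto ::
    "real \<Rightarrow> ('b \<Rightarrow> nat \<Rightarrow> real) \<Rightarrow> (nat \<Rightarrow> real) \<Rightarrow> 'b filter \<Rightarrow> bool" where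
  "lp_tendsto p f l F \<longleftrightarrow>
     l \<in> lp p \<and> (\<forall>\<^sub>F s in F. f s \<in> lp p) \<and>
     ((\<lambda>s. lp_norm p (\<lambda>n. f s n - l n)) \<longlongrightarrow> 0) F"

definition lp_diff_quot ::
    "((nat \<Rightarrow> real) \<Rightarrow> nat \<Rightarrow> real) \<Rightarrow> (nat \<Rightarrow> real) \<Rightarrow> (nat \<Rightarrow> real) \<Rightarrow> real \<Rightarrow> nat \<Rightarrow> real" where
  "lp_diff_quot T x v t = (\<lambda>n. (T (\<lambda>k. x k + t * v k) n - T x n) / t)"

definition gateaux_differentiable_at ::
    "real \<Rightarrow> ((nat \<Rightarrow> real) \<Rightarrow> nat \<Rightarrow> real) \<Rightarrow> (nat \<Rightarrow> real) \<Rightarrow> bool" where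
  "gateaux_differentiable_at p T x \<longleftrightarrow>
     (\<forall>v \<in> lp p - {lp_zero}. \<exists>w. lp_tendsto p (lp_diff_quot T x v) w (at 0))"

definition gateaux_deriv ::
    "real \<Rightarrow> ((nat \<Rightarrow> real) \<Rightarrow> nat \<Rightarrow> real) \<Rightarrow> (nat \<Rightarrow> real) \<Rightarrow> (nat \<Rightarrow> real) \<Rightarrow> nat \<Rightarrow> real" where
  "gateaux_deriv p T x v = (THE w. lp_tendsto p (lp_diff_quot T x v) w (at 0))"

text \<open>The analogue of \<^const>\<open>bounded_linear\<close> for operators on the carrier.\<close>

definition lp_bounded_linear :: "real \<Rightarrow> ((nat \<Rightarrow> real) \<Rightarrow> nat \<Rightarrow> real) \<Rightarrow> bool" where
  "lp_bounded_linear p D \<longleftrightarrow>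
     D \<in> lp p \<rightarrow> lp p \<and>
     (\<forall>u \<in> lp p. \<forall>v \<in> lp p. D (\<lambda>n. u n + v n) = (\<lambda>n. D u n + D v n)) \<and>
     (\<forall>c. \<forall>u \<in> lp p. D (\<lambda>n. c * u n) = (\<lambda>n. c * D u n)) \<and>
     (\<exists>K. \<forall>u \<in> lp p. lp_norm p (D u) \<le> K * lp_norm p u)"

text \<open>
  The filter of $u \to \theta_p$, $u \neq \theta_p$ in $l_p$: it is generated by the sets
  $\{u \in l_p : 0 < \|u\|_p < \delta\}$ for $\delta > 0$.
\<close>

definition lp_at_zero :: "real \<Rightarrow> (nat \<Rightarrow> real) filter" where
  "lp_at_zero p = inf (filtercomap (lp_norm p) (at_right 0)) (principal (lp p))"

definition has_lp_frechet_deriv ::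
    "real \<Rightarrow> ((nat \<Rightarrow> real) \<Rightarrow> nat \<Rightarrow> real) \<Rightarrow> (nat \<Rightarrow> real) \<Rightarrow>
     ((nat \<Rightarrow> real) \<Rightarrow> nat \<Rightarrow> real) \<Rightarrow> bool" where
  "has_lp_frechet_deriv p T x D \<longleftrightarrow>
     lp_bounded_linear p D \<and>
     lp_tendsto p (\<lambda>u n. (T (\<lambda>k. x k + u k) n - T x n - D u n) / lp_norm p u)
       lp_zero (lp_at_zero p)"

definition lp_frechet_differentiable_at ::
    "real \<Rightarrow> ((nat \<Rightarrow> real) \<Rightarrow> nat \<Rightarrow> real) \<Rightarrow> (nat \<Rightarrow> real) \<Rightarrow> bool" where
  "lp_frechet_differentiable_at p T x \<longleftrightarrow> (\<exists>D. has_lp_frechet_deriv p T x D)"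

text \<open>
  The derivative is unique only as an operator on the carrier \<^term>\<open>lp p\<close>, as its values elsewhere
  are unconstrained; hence \<open>SOME\<close> rather than \<open>THE\<close>.
\<close>

definition lp_frechet_deriv ::
    "real \<Rightarrow> ((nat \<Rightarrow> real) \<Rightarrow> nat \<Rightarrow> real) \<Rightarrow> (nat \<Rightarrow> real) \<Rightarrow> (nat \<Rightarrow> real) \<Rightarrow> nat \<Rightarrow> real" where
  "lp_frechet_deriv p T x = (SOME D. has_lp_frechet_deriv p T x D)"

definition lp_represented_by ::
    "real \<Rightarrow> ((nat \<Rightarrow> real) \<Rightarrow> nat \<Rightarrow> real) \<Rightarrow> (nat \<Rightarrow> nat \<Rightarrow> real) \<Rightarrow> bool" where
  "lp_represented_by p D M \<longleftrightarrow> (\<forall>v \<in> lp p. \<forall>n. (\<lambda>k. M n k * v k) sums D v n)"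

definition diag_matrix :: "(nat \<Rightarrow> real) \<Rightarrow> nat \<Rightarrow> nat \<Rightarrow> real" where
  "diag_matrix d = (\<lambda>n k. if n = k then d n else 0)"

definition poly_op :: "nat \<Rightarrow> (nat \<Rightarrow> real) \<Rightarrow> (nat \<Rightarrow> real) \<Rightarrow> nat \<Rightarrow> real" where
  "poly_op m a x = (\<lambda>n. \<Sum>i = 1..m. a i * x n ^ i)"

end

theory Submission
  imports Defs
begin

text \<open>
  A function \<open>f\<close> on the line with \<open>f(t + s) = f(t) + g(t) s + O(s\<^sup>2)\<close>, uniformly for bounded \<open>t\<close> and
  \<open>\<bar>s\<bar> \<le> 1\<close>, acts on $l_p$ coordinatewise, and there the remainder of the linearization is
  $O(|u_n|^2) \le O(\|u\|_p\,|u_n|)$, because $|u_n| \le \|u\|_p$. Dividing by $\|u\|_p$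
  leaves a sequence dominated by a constant multiple of $u$, whose norm tends to $0$ with $u$. This
  is norm differentiability, and the directional derivatives follow; uniqueness of limits is read off
  coordinates.
\<close>

section \<open>The spaces $l_p$\<close>

text \<open>Monotonicity of \<open>powr\<close> and comparison of series, with the constant pulled
  out as \<open>c powr p\<close> and restored by the root. It turns coordinatewise bounds on
  operators and remainders into norm bounds.\<close>

lemma lp_dominated:
  assumes "0 < p" "0 \<le> c" "y \<in> lp p" "\<And>n. \<bar>x n\<bar> \<le> c * \<bar>y n\<bar>"
  shows "x \<in> lp p" and "lp_norm p x \<le> c * lp_norm p y"
proof -
  have le: "\<bar>x n\<bar> powr p \<le> c powr p * \<bar>y n\<bar> powr p" for n
    using powr_mono2[of p "\<bar>x n\<bar>" "c * \<bar>y n\<bar>"] assms by (simp add: powr_mult)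
  have sy: "summable (\<lambda>n. \<bar>y n\<bar> powr p)"
    using assms by (simp add: lp_def)
  then have sc: "summable (\<lambda>n. c powr p * \<bar>y n\<bar> powr p)"
    by (rule summable_mult)
  have sx: "summable (\<lambda>n. \<bar>x n\<bar> powr p)"
    by (rule summable_comparison_test'[OF sc, of 0]) (use le in auto)
  then show "x \<in> lp p"
    by (simp add: lp_def)
  have "(\<Sum>n. \<bar>x n\<bar> powr p) \<le> (\<Sum>n. c powr p * \<bar>y n\<bar> powr p)"
    by (rule suminf_le[OF le sx sc])
  also have "\<dots> = c powr p * (\<Sum>n. \<bar>y n\<bar> powr p)"
    by (rule suminf_mult[OF sy])
  finally have "lp_norm p x \<le> (c powr p * (\<Sum>n. \<bar>y n\<bar> powr p)) powr (1 / p)"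
    unfolding lp_norm_def using assms sx by (intro powr_mono2) (auto intro: suminf_nonneg)
  also have "\<dots> = c * lp_norm p y"
    using assms sy by (simp add: powr_mult suminf_nonneg powr_powr lp_norm_def)
  finally show "lp_norm p x \<le> c * lp_norm p y" .
qed

lemma lp_norm_nonneg: "0 \<le> lp_norm p x"
  by (simp add: lp_norm_def)

lemma lp_zero_in_lp: "lp_zero \<in> lp p"
  by (simp add: lp_zero_def lp_def)

lemma lp_norm_zero: "lp_norm p (\<lambda>n. 0) = 0"
  by (simp add: lp_norm_def)

lemma lp_scale:
  assumes "0 < p" "x \<in> lp p"
  shows "(\<lambda>n. c * x n) \<in> lp p" and "lp_norm p (\<lambda>n. c * x n) = \<bar>c\<bar> * lp_norm p x"
proof -
  show in_lp: "(\<lambda>n. c * x n) \<in> lp p"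
    by (rule lp_dominated(1)[of p "\<bar>c\<bar>" x]) (use assms in \<open>auto simp: abs_mult\<close>)
  show "lp_norm p (\<lambda>n. c * x n) = \<bar>c\<bar> * lp_norm p x"
  proof (cases "c = 0")
    case True
    then show ?thesis by (simp add: lp_norm_zero)
  next
    case False
    \<comment> \<open>Domination works in both directions: \<open>x\<close> is itself a multiple of
      \<open>c * x\<close>, by the factor \<open>1 / c\<close>.\<close>
    have "lp_norm p x \<le> (1 / \<bar>c\<bar>) * lp_norm p (\<lambda>n. c * x n)"
      by (rule lp_dominated(2)) (use assms in_lp False in \<open>auto simp: abs_mult\<close>)
    moreover have "lp_norm p (\<lambda>n. c * x n) \<le> \<bar>c\<bar> * lp_norm p x"
      by (rule lp_dominated(2)) (use assms in \<open>auto simp: abs_mult\<close>)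
    ultimately show ?thesis
      using False by (simp add: field_simps)
  qed
qed

text \<open>Each summand is at most the larger of the two absolute values, and the power of a
  maximum is at most the sum of the powers.\<close>

lemma lp_add:
  assumes "0 < p" "x \<in> lp p" "y \<in> lp p"
  shows "(\<lambda>n. x n + y n) \<in> lp p"
proof -
  have le: "\<bar>x n + y n\<bar> powr p \<le> 2 powr p * (\<bar>x n\<bar> powr p + \<bar>y n\<bar> powr p)" for n
  proof -
    have "\<bar>x n + y n\<bar> powr p \<le> (2 * max \<bar>x n\<bar> \<bar>y n\<bar>) powr p"
      using assms by (intro powr_mono2) auto
    also have "\<dots> = 2 powr p * max \<bar>x n\<bar> \<bar>y n\<bar> powr p"
      by (simp add: powr_mult)
    also have "\<dots> \<le> 2 powr p * (\<bar>x n\<bar> powr p + \<bar>y n\<bar> powr p)"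
      by (intro mult_left_mono) (auto simp: max_def)
    finally show ?thesis .
  qed
  have "summable (\<lambda>n. 2 powr p * (\<bar>x n\<bar> powr p + \<bar>y n\<bar> powr p))"
    using assms by (intro summable_mult summable_add) (auto simp: lp_def)
  then have "summable (\<lambda>n. \<bar>x n + y n\<bar> powr p)"
    by (rule summable_comparison_test'[of _ 0]) (use le in auto)
  then show ?thesis
    by (simp add: lp_def)
qed

text \<open>One term of a nonnegative series is at most its sum. This embedding into the bounded
  sequences confines the coordinates of the base point to a fixed interval and makes increments
  uniformly small.\<close>

lemma abs_le_lp_norm:
  assumes "0 < p" "x \<in> lp p"
  shows "\<bar>x n\<bar> \<le> lp_norm p x"
proof -
  have s: "summable (\<lambda>n. \<bar>x n\<bar> powr p)"
    using assms by (simp add: lp_def)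
  have "\<bar>x n\<bar> powr p \<le> (\<Sum>n. \<bar>x n\<bar> powr p)"
    using sum_le_suminf[OF s, of "{n}"] by simp
  then have "(\<bar>x n\<bar> powr p) powr (1 / p) \<le> lp_norm p x"
    unfolding lp_norm_def using assms by (intro powr_mono2) auto
  then show ?thesis
    using assms by (simp add: powr_powr)
qed

lemma lp_norm_pos:
  assumes "0 < p" "x \<in> lp p" "x \<noteq> lp_zero"
  shows "0 < lp_norm p x"
proof -
  obtain n where "x n \<noteq> 0"
    using assms(3) by (auto simp: lp_zero_def)
  then show ?thesis
    using abs_le_lp_norm[OF assms(1,2), of n] by linarith
qed

text \<open>Evaluation at \<open>n\<close> does not increase the norm, so norm convergence passes to
  each coordinate.\<close>

lemma lp_tendsto_coordinate:
  assumes "0 < p" "lp_tendsto p f l F"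
  shows "((\<lambda>s. f s n) \<longlongrightarrow> l n) F"
proof -
  have "\<forall>\<^sub>F s in F. \<bar>f s n - l n\<bar> \<le> lp_norm p (\<lambda>n. f s n - l n)"
  proof -
    have "\<forall>\<^sub>F s in F. f s \<in> lp p"
      using assms by (simp add: lp_tendsto_def)
    then show ?thesis
    proof eventually_elim
      case (elim s)
      \<comment> \<open>The difference is written as a sum with a scalar multiple so that the
        closure properties apply.\<close>
      have "(\<lambda>n. f s n + (- 1) * l n) \<in> lp p"
        using assms elim by (intro lp_add lp_scale(1)) (auto simp: lp_tendsto_def)
      then show ?case
        using abs_le_lp_norm[OF assms(1), of "\<lambda>n. f s n - l n" n] by simp
    qed
  qed
  moreover have "((\<lambda>s. lp_norm p (\<lambda>n. f s n - l n)) \<longlongrightarrow> 0) F"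
    using assms by (simp add: lp_tendsto_def)
  ultimately have "((\<lambda>s. f s n - l n) \<longlongrightarrow> 0) F"
    by (auto simp: lp_norm_nonneg intro: tendsto_0_le[where K = 1])
  then show ?thesis
    by (rule LIM_zero_cancel)
qed

lemma lp_tendsto_unique:
  assumes "0 < p" "F \<noteq> bot" "lp_tendsto p f l F" "lp_tendsto p f l' F"
  shows "l = l'"
proof
  fix n
  show "l n = l' n"
    by (rule tendsto_unique[OF assms(2) assms(3,4)[THEN lp_tendsto_coordinate[OF assms(1)]]])
qed

section \<open>Differentiation in $l_p$\<close>

lemma tendsto_lp_norm_at_zero: "(lp_norm p \<longlongrightarrow> 0) (lp_at_zero p)"
proof -
  have "filterlim (lp_norm p) (at_right 0) (filtercomap (lp_norm p) (at_right 0))"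
    by (rule filterlim_filtercomap)
  then have "filterlim (lp_norm p) (at_right 0) (lp_at_zero p)"
    unfolding lp_at_zero_def by (rule filterlim_mono) auto
  then show ?thesis
    by (simp add: filterlim_at)
qed

text \<open>Punctured balls belong to the filter; the positive norm is what permits division by
  it.\<close>

lemma eventually_lp_at_zero:
  assumes "0 < d"
  shows "\<forall>\<^sub>F u in lp_at_zero p. u \<in> lp p \<and> 0 < lp_norm p u \<and> lp_norm p u < d"
proof -
  have "\<forall>\<^sub>F r in at_right 0. 0 < r \<and> r < (d::real)"
    using assms by (auto simp: eventually_at_right)
  then have "\<forall>\<^sub>F u in filtercomap (lp_norm p) (at_right 0). 0 < lp_norm p u \<and> lp_norm p u < d"
    by (rule eventually_filtercomapI)
  then show ?thesis
    unfolding lp_at_zero_def eventually_inf_principal by eventually_elim auto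
qed

text \<open>The norm of \<open>t * v\<close> is \<open>\<bar>t\<bar>\<close> times the positive norm
  of \<open>v\<close>, so the line through \<open>v\<close> approaches the origin without meeting it
  for \<open>t \<noteq> 0\<close>. Limits along \<open>lp_at_zero\<close> can thus be pulled back to
  directional limits.\<close>

lemma filterlim_scale_lp_at_zero:
  assumes "0 < p" "v \<in> lp p" "v \<noteq> lp_zero"
  shows "filterlim (\<lambda>t n. t * v n) (lp_at_zero p) (at 0)"
proof -
  have pos: "0 < lp_norm p v"
    using assms by (rule lp_norm_pos)
  have "((\<lambda>t. \<bar>t\<bar> * lp_norm p v) \<longlongrightarrow> 0) (at (0::real))"
    by (auto intro!: tendsto_eq_intros)
  moreover have "\<forall>\<^sub>F t in at (0::real). \<bar>t\<bar> * lp_norm p v \<in> {0<..} \<and> \<bar>t\<bar> * lp_norm p v \<noteq> 0"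
    using pos by (auto simp: eventually_at_filter)
  ultimately have "filterlim (\<lambda>t. \<bar>t\<bar> * lp_norm p v) (at_right 0) (at (0::real))"
    by (simp add: filterlim_at)
  then have "filterlim (\<lambda>t. lp_norm p (\<lambda>n. t * v n)) (at_right 0) (at (0::real))"
    using assms by (simp add: lp_scale(2))
  then show ?thesis
    unfolding lp_at_zero_def using assms
    by (auto simp: filterlim_inf filterlim_principal filterlim_filtercomap_iff comp_def
        intro!: always_eventually lp_scale(1))
qed

text \<open>Homogeneity with scalar 0. Directional limits are taken only along nonzero
  \<open>v\<close>, so uniqueness of the derivative at the origin rests on this.\<close>

lemma has_lp_frechet_deriv_zero:
  assumes "has_lp_frechet_deriv p T x D"
  shows "D lp_zero = lp_zero"
proof -
  have "D (\<lambda>n. 0 * lp_zero n) = (\<lambda>n. 0 * D lp_zero n)"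
    using assms lp_zero_in_lp unfolding has_lp_frechet_deriv_def lp_bounded_linear_def by blast
  then show ?thesis
    by (simp add: lp_zero_def)
qed

text \<open>Substitute \<open>u = t * v\<close> in the normalized remainder and let \<open>t\<close>
  tend to 0.\<close>

lemma has_lp_frechet_deriv_imp_gateaux:
  assumes p: "0 < p" and D: "has_lp_frechet_deriv p T x D" and v: "v \<in> lp p - {lp_zero}"
  shows "lp_tendsto p (lp_diff_quot T x v) (D v) (at 0)"
proof -
  define R where "R u = (\<lambda>n. (T (\<lambda>k. x k + u k) n - T x n - D u n) / lp_norm p u)" for u
  let ?N = "lp_norm p v"
  have pos: "0 < ?N"
    using lp_norm_pos p v by auto
  have bl: "lp_bounded_linear p D" and R: "lp_tendsto p R lp_zero (lp_at_zero p)"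
    using D unfolding has_lp_frechet_deriv_def R_def by auto
  have Dv: "D v \<in> lp p"
    using bl v by (auto simp: lp_bounded_linear_def)
  have D_scale: "D (\<lambda>n. t * v n) = (\<lambda>n. t * D v n)" for t
    using bl v by (auto simp: lp_bounded_linear_def)
  have lim: "filterlim (\<lambda>t n. t * v n) (lp_at_zero p) (at 0)"
    using filterlim_scale_lp_at_zero p v by blast
  have R_in: "\<forall>\<^sub>F t in at 0. R (\<lambda>n. t * v n) \<in> lp p"
    using R lim by (auto simp: lp_tendsto_def dest: eventually_compose_filterlim)
  have "((\<lambda>u. lp_norm p (R u)) \<longlongrightarrow> 0) (lp_at_zero p)"
    using R by (simp add: lp_tendsto_def lp_zero_def)
  then have R_lim: "((\<lambda>t. lp_norm p (R (\<lambda>n. t * v n))) \<longlongrightarrow> 0) (at 0)"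
    using lim by (rule filterlim_compose)
  have ne: "\<forall>\<^sub>F t in at (0::real). t \<noteq> 0"
    by (simp add: eventually_at_filter)
  \<comment> \<open>The remainder is normalized by \<open>\<bar>t\<bar> * ?N\<close>, the quotient
    by \<open>t\<close>; the conversion factor has absolute value \<open>?N\<close>, so it stays
    bounded as \<open>t\<close> tends to 0.\<close>
  have diff: "lp_diff_quot T x v t n - D v n = (\<bar>t\<bar> * ?N / t) * R (\<lambda>n. t * v n) n"
    if "t \<noteq> 0" for t n
    using that pos v p
    by (auto simp: R_def lp_diff_quot_def D_scale lp_scale(2) field_simps)
  have "\<forall>\<^sub>F t in at 0. lp_diff_quot T x v t \<in> lp p"
    using R_in ne
  proof eventually_elim
    case (elim t)
    \<comment> \<open>Membership of the quotient is recovered from that of the remainder by adding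
      \<open>D v\<close> back.\<close>
    have "(\<lambda>n. (\<bar>t\<bar> * ?N / t) * R (\<lambda>n. t * v n) n + D v n) \<in> lp p"
      by (intro lp_add lp_scale(1) p elim(1) Dv)
    also have "(\<lambda>n. (\<bar>t\<bar> * ?N / t) * R (\<lambda>n. t * v n) n + D v n) = lp_diff_quot T x v t"
      by (simp only: diff[OF elim(2), symmetric] diff_add_cancel)
    finally show ?case .
  qed
  moreover have "((\<lambda>t. lp_norm p (\<lambda>n. lp_diff_quot T x v t n - D v n)) \<longlongrightarrow> 0) (at 0)"
  proof -
    have "\<forall>\<^sub>F t in at 0. ?N * lp_norm p (R (\<lambda>n. t * v n)) =
        lp_norm p (\<lambda>n. lp_diff_quot T x v t n - D v n)"
      using R_in ne
    proof eventually_elim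
      case (elim t)
      show ?case
        unfolding diff[OF elim(2)] lp_scale(2)[OF p elim(1)] using elim pos by (simp add: abs_mult)
    qed
    moreover have "((\<lambda>t. ?N * lp_norm p (R (\<lambda>n. t * v n))) \<longlongrightarrow> 0) (at 0)"
      using tendsto_mult_left[OF R_lim, of ?N] by simp
    ultimately show ?thesis
      by (rule Lim_transform_eventually[rotated])
  qed
  ultimately show ?thesis
    using Dv by (simp add: lp_tendsto_def)
qed

lemma gateaux_deriv_eq:
  assumes "0 < p" "has_lp_frechet_deriv p T x D" "v \<in> lp p - {lp_zero}"
  shows "gateaux_deriv p T x v = D v"
  unfolding gateaux_deriv_def
proof (rule the_equality)
  show D: "lp_tendsto p (lp_diff_quot T x v) (D v) (at 0)"
    by (rule has_lp_frechet_deriv_imp_gateaux[OF assms])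
  show "w = D v" if "lp_tendsto p (lp_diff_quot T x v) w (at 0)" for w
    by (rule lp_tendsto_unique[OF assms(1) at_neq_bot that D])
qed

text \<open>The operator picked by \<open>SOME\<close> and the given \<open>D\<close> both compute
  the same unique Gateaux derivative at nonzero \<open>v\<close>, and both vanish at the
  origin.\<close>

lemma lp_frechet_deriv_eq:
  assumes "0 < p" "has_lp_frechet_deriv p T x D" "v \<in> lp p"
  shows "lp_frechet_deriv p T x v = D v"
proof -
  have D': "has_lp_frechet_deriv p T x (lp_frechet_deriv p T x)"
    unfolding lp_frechet_deriv_def by (rule someI[of _ D]) (rule assms(2))
  show ?thesis
  proof (cases "v = lp_zero")
    case True
    then show ?thesis
      using has_lp_frechet_deriv_zero[OF D'] has_lp_frechet_deriv_zero[OF assms(2)] by simp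
  next
    case False
    then show ?thesis
      using assms gateaux_deriv_eq[OF assms(1) D', of v] gateaux_deriv_eq[OF assms(1,2), of v] by simp
  qed
qed

section \<open>Superposition operators\<close>

lemma lp_bounded_linear_diag:
  assumes "0 < p" "\<And>n. \<bar>d n\<bar> \<le> K"
  shows "lp_bounded_linear p (\<lambda>u n. d n * u n)"
proof -
  have "0 \<le> K"
    using assms(2)[of 0] by linarith
  have le: "\<And>n. \<bar>d n * u n\<bar> \<le> K * \<bar>u n\<bar>" for u :: "nat \<Rightarrow> real"
    using assms(2) by (simp add: abs_mult mult_right_mono)
  have "(\<lambda>u n. d n * u n) \<in> lp p \<rightarrow> lp p"
    by (intro funcsetI lp_dominated(1)[OF assms(1) \<open>0 \<le> K\<close> _ le])
  moreover have "\<exists>K. \<forall>u\<in>lp p. lp_norm p (\<lambda>n. d n * u n) \<le> K * lp_norm p u"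
    by (intro exI[of _ K] ballI lp_dominated(2)[OF assms(1) \<open>0 \<le> K\<close> _ le])
  ultimately show ?thesis
    by (simp add: lp_bounded_linear_def algebra_simps)
qed

text \<open>The constants \<open>K\<close> and \<open>C\<close> are uniform in \<open>n\<close>:
  \<open>K\<close> bounds the diagonal operator, and \<open>C\<close> lets the coordinatewise
  quadratic estimate become a norm estimate.\<close>

lemma has_lp_frechet_deriv_superposition:
  assumes p: "0 < p"
    and g: "\<And>n. \<bar>g (x n)\<bar> \<le> K"
    and rem: "\<And>n s. \<bar>s\<bar> \<le> 1 \<Longrightarrow> \<bar>f (x n + s) - f (x n) - g (x n) * s\<bar> \<le> C * s\<^sup>2"
  shows "has_lp_frechet_deriv p (\<lambda>x n. f (x n)) x (\<lambda>u n. g (x n) * u n)"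
proof -
  define R where "R u = (\<lambda>n. (f (x n + u n) - f (x n) - g (x n) * u n) / lp_norm p u)" for u
  \<comment> \<open>The choice \<open>s = 1\<close> at coordinate 0 bounds \<open>C\<close> below by
    an absolute value.\<close>
  have C: "0 \<le> C"
    using rem[of 1 0] by simp
  have "R u \<in> lp p \<and> lp_norm p (R u) \<le> C * lp_norm p u"
    if u: "u \<in> lp p" "0 < lp_norm p u" "lp_norm p u < 1" for u
  proof -
    have "\<bar>R u n\<bar> \<le> C * \<bar>u n\<bar>" for n
    proof -
      have un: "\<bar>u n\<bar> \<le> lp_norm p u"
        by (rule abs_le_lp_norm[OF p u(1)])
      have "\<bar>f (x n + u n) - f (x n) - g (x n) * u n\<bar> \<le> C * (\<bar>u n\<bar> * \<bar>u n\<bar>)"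
        using rem[of "u n" n] un u by (simp add: power2_eq_square)
      \<comment> \<open>Only one factor of the square is replaced by the norm: it cancels the
        divisor in \<open>R\<close>, while the other keeps the bound summable.\<close>
      also have "\<dots> \<le> C * (\<bar>u n\<bar> * lp_norm p u)"
        using un C by (intro mult_left_mono) auto
      finally show ?thesis
        using u by (simp add: R_def field_simps)
    qed
    then show ?thesis
      using lp_dominated[OF p C u(1)] by blast
  qed
  then have ev: "\<forall>\<^sub>F u in lp_at_zero p. R u \<in> lp p \<and> lp_norm p (R u) \<le> C * lp_norm p u"
    using eventually_lp_at_zero[of 1 p] by (auto elim!: eventually_mono)
  moreover have "((\<lambda>u. lp_norm p (R u)) \<longlongrightarrow> 0) (lp_at_zero p)"
  proof (rule tendsto_0_le[OF tendsto_lp_norm_at_zero])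
    show "\<forall>\<^sub>F u in lp_at_zero p. norm (lp_norm p (R u)) \<le> norm (lp_norm p u) * C"
      using ev by (auto simp: lp_norm_nonneg mult.commute elim: eventually_mono)
  qed
  ultimately have "lp_tendsto p R lp_zero (lp_at_zero p)"
    by (auto simp: lp_tendsto_def lp_zero_in_lp lp_zero_def elim: eventually_mono
        intro: lp_zero_in_lp[unfolded lp_zero_def])
  then show ?thesis
    using lp_bounded_linear_diag[of p "\<lambda>n. g (x n)" K, OF p g]
    by (simp add: has_lp_frechet_deriv_def R_def[abs_def])
qed

section \<open>Polynomials\<close>

text \<open>Induction on the exponent: multiplying the expansion of \<open>(t + s) ^ i\<close> with
  remainder \<open>r\<close> by \<open>t + s\<close> gives the new remainder
  \<open>(t + s) * r + i * t ^ (i - 1) * s\<^sup>2\<close>, where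
  \<open>\<bar>t + s\<bar> \<le> B + 1\<close>.\<close>

lemma power_linearization_bound:
  assumes "0 \<le> B"
  shows "\<exists>C. \<forall>t s. \<bar>t\<bar> \<le> B \<longrightarrow> \<bar>s\<bar> \<le> 1 \<longrightarrow>
    \<bar>(t + s) ^ i - t ^ i - real i * t ^ (i - 1) * s\<bar> \<le> C * s\<^sup>2"
proof (induction i)
  case 0
  show ?case by (auto intro!: exI[of _ 0])
next
  case (Suc i)
  then obtain C where C: "\<And>t s. \<bar>t\<bar> \<le> B \<Longrightarrow> \<bar>s\<bar> \<le> 1 \<Longrightarrow>
      \<bar>(t + s) ^ i - t ^ i - real i * t ^ (i - 1) * s\<bar> \<le> C * s\<^sup>2"
    by blast
  have "\<bar>(t + s) ^ Suc i - t ^ Suc i - real (Suc i) * t ^ (Suc i - 1) * s\<bar> \<le>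
      ((B + 1) * C + real i * B ^ (i - 1)) * s\<^sup>2"
    if t: "\<bar>t\<bar> \<le> B" and s: "\<bar>s\<bar> \<le> 1" for t s
  proof -
    define r where "r = (t + s) ^ i - t ^ i - real i * t ^ (i - 1) * s"
    have "(t + s) ^ Suc i - t ^ Suc i - real (Suc i) * t ^ (Suc i - 1) * s =
        (t + s) * r + real i * t ^ (i - 1) * s\<^sup>2"
      \<comment> \<open>The split is due to truncated subtraction in \<open>i - 1\<close>; at
        \<open>i = 0\<close> the coefficient \<open>real i\<close> removes the term.\<close>
      by (cases i) (simp_all add: r_def algebra_simps power2_eq_square)
    moreover have "\<bar>(t + s) * r\<bar> \<le> (B + 1) * (C * s\<^sup>2)"
      unfolding abs_mult using C[OF t s] t s assms by (intro mult_mono) (auto simp: r_def)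
    moreover have "\<bar>real i * t ^ (i - 1) * s\<^sup>2\<bar> \<le> real i * B ^ (i - 1) * s\<^sup>2"
      using t by (auto simp: abs_mult power_abs intro!: mult_mono power_mono)
    ultimately show ?thesis
      by (simp add: algebra_simps)
  qed
  then show ?case by blast
qed

lemma polynomial_linearization_bound:
  fixes a :: "nat \<Rightarrow> real"
  assumes "0 \<le> B"
  shows "\<exists>C. \<forall>t s. \<bar>t\<bar> \<le> B \<longrightarrow> \<bar>s\<bar> \<le> 1 \<longrightarrow>
    \<bar>(\<Sum>i\<in>I. a i * (t + s) ^ i) - (\<Sum>i\<in>I. a i * t ^ i) - (\<Sum>i\<in>I. real i * a i * t ^ (i - 1)) * s\<bar>
      \<le> C * s\<^sup>2"
proof -
  \<comment> \<open>One constant is chosen for each exponent; by linearity they combine with weights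
    \<open>\<bar>a i\<bar>\<close>.\<close>
  obtain C where C: "\<And>i t s. \<bar>t\<bar> \<le> B \<Longrightarrow> \<bar>s\<bar> \<le> 1 \<Longrightarrow>
      \<bar>(t + s) ^ i - t ^ i - real i * t ^ (i - 1) * s\<bar> \<le> C i * s\<^sup>2"
    using power_linearization_bound[OF assms] by metis
  have "\<bar>(\<Sum>i\<in>I. a i * (t + s) ^ i) - (\<Sum>i\<in>I. a i * t ^ i)
      - (\<Sum>i\<in>I. real i * a i * t ^ (i - 1)) * s\<bar> \<le> (\<Sum>i\<in>I. \<bar>a i\<bar> * C i) * s\<^sup>2"
    if "\<bar>t\<bar> \<le> B" "\<bar>s\<bar> \<le> 1" for t s
  proof -
    have "(\<Sum>i\<in>I. a i * (t + s) ^ i) - (\<Sum>i\<in>I. a i * t ^ i)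
        - (\<Sum>i\<in>I. real i * a i * t ^ (i - 1)) * s =
        (\<Sum>i\<in>I. a i * ((t + s) ^ i - t ^ i - real i * t ^ (i - 1) * s))"
      by (simp add: sum_distrib_left sum_subtractf right_diff_distrib mult_ac)
    also have "\<bar>\<dots>\<bar> \<le> (\<Sum>i\<in>I. \<bar>a i\<bar> * (C i * s\<^sup>2))"
      by (rule order_trans[OF sum_abs])
        (unfold abs_mult, intro sum_mono mult_left_mono C that abs_ge_zero)
    finally show ?thesis
      by (simp add: sum_distrib_right mult.assoc)
  qed
  then show ?thesis by blast
qed

text \<open>The coefficients are left general because the bound serves both the cofactor of
  \<open>x n\<close> in the operator and the diagonal of its derivative.\<close>

lemma abs_polynomial_le:
  fixes t :: real
  assumes "\<bar>t\<bar> \<le> B"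
  shows "\<bar>\<Sum>i\<in>I. c i * t ^ (e i)\<bar> \<le> (\<Sum>i\<in>I. \<bar>c i\<bar> * B ^ (e i))"
  using assms
  by (intro order_trans[OF sum_abs] sum_mono) (auto simp: abs_mult power_abs intro!: mult_left_mono power_mono)

text \<open>The sum starts at \<open>i = 1\<close>, so a factor \<open>x n\<close> splits off, and
  the remaining polynomial is bounded on the interval containing all coordinates.\<close>

lemma poly_op_in_lp:
  assumes p: "0 < p" and x: "x \<in> lp p"
  shows "poly_op m a x \<in> lp p"
proof (rule lp_dominated(1)[OF p _ x])
  let ?K = "\<Sum>i = 1..m. \<bar>a i\<bar> * lp_norm p x ^ (i - 1)"
  show "0 \<le> ?K"
    by (intro sum_nonneg mult_nonneg_nonneg) (auto simp: lp_norm_nonneg)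
  fix n
  have "poly_op m a x n = (\<Sum>i = 1..m. a i * x n ^ (i - 1)) * x n"
    unfolding poly_op_def sum_distrib_right
    by (intro sum.cong) (auto simp: power_eq_if)
  then show "\<bar>poly_op m a x n\<bar> \<le> ?K * \<bar>x n\<bar>"
    using mult_right_mono[OF abs_polynomial_le[OF abs_le_lp_norm[OF p x]] abs_ge_zero]
    by (simp only: abs_mult)
qed

text \<open>The linearization bound is applied with \<open>B\<close> the norm of \<open>x\<close>,
  which bounds every coordinate, so that \<open>C\<close> is independent of
  \<open>n\<close>.\<close>

lemma has_lp_frechet_deriv_poly_op:
  assumes p: "0 < p" and x: "x \<in> lp p"
  shows "has_lp_frechet_deriv p (poly_op m a) x
    (\<lambda>v n. (\<Sum>i = 1..m. real i * a i * x n ^ (i - 1)) * v n)"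
proof -
  obtain C where C: "\<And>t s. \<bar>t\<bar> \<le> lp_norm p x \<Longrightarrow> \<bar>s\<bar> \<le> 1 \<Longrightarrow>
      \<bar>(\<Sum>i = 1..m. a i * (t + s) ^ i) - (\<Sum>i = 1..m. a i * t ^ i)
        - (\<Sum>i = 1..m. real i * a i * t ^ (i - 1)) * s\<bar> \<le> C * s\<^sup>2"
    using polynomial_linearization_bound[OF lp_norm_nonneg] by blast
  have "poly_op m a = (\<lambda>x n. \<Sum>i = 1..m. a i * x n ^ i)"
    by (simp add: poly_op_def fun_eq_iff)
  then show ?thesis
    using has_lp_frechet_deriv_superposition[OF p,
        where f = "\<lambda>t. \<Sum>i = 1..m. a i * t ^ i" and g = "\<lambda>t. \<Sum>i = 1..m. real i * a i * t ^ (i - 1)",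
        OF abs_polynomial_le[OF abs_le_lp_norm[OF p x]] C[OF abs_le_lp_norm[OF p x]]]
    by simp
qed

theorem corollary3p3:
  fixes p :: real and m :: nat and a :: "nat \<Rightarrow> real"
  assumes "1 < p" and "1 \<le> m"
  shows "poly_op m a \<in> lp p \<rightarrow> lp p \<and>
    (\<forall>x \<in> lp p.
       gateaux_differentiable_at p (poly_op m a) x \<and>
       lp_frechet_differentiable_at p (poly_op m a) x \<and>
       (1 < m \<longrightarrow>
          lp_represented_by p (lp_frechet_deriv p (poly_op m a) x)
            (diag_matrix (\<lambda>n. \<Sum>i = 1..m. real i * a i * x n ^ (i - 1))) \<and>
          (\<forall>v \<in> lp p - {lp_zero}.
             gateaux_deriv p (poly_op m a) x v = lp_frechet_deriv p (poly_op m a) x v \<and>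
             lp_frechet_deriv p (poly_op m a) x v =
               (\<lambda>n. \<Sum>i = 1..m. real i * a i * x n ^ (i - 1) * v n))) \<and>
       (m = 1 \<longrightarrow>
          (\<forall>v \<in> lp p - {lp_zero}.
             gateaux_deriv p (poly_op m a) x v = lp_frechet_deriv p (poly_op m a) x v \<and>
             lp_frechet_deriv p (poly_op m a) x v = (\<lambda>n. a 1 * v n) \<and>
             (\<lambda>n. a 1 * v n) \<in> lp p)))"
proof (intro conjI ballI impI)
  have p: "0 < p"
    using assms by simp
  show "poly_op m a \<in> lp p \<rightarrow> lp p"
    using poly_op_in_lp[OF p] by blast
  fix x
  assume x: "x \<in> lp p"
  let ?D = "\<lambda>v n. (\<Sum>i = 1..m. real i * a i * x n ^ (i - 1)) * v n"
  have D: "has_lp_frechet_deriv p (poly_op m a) x ?D"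
    by (rule has_lp_frechet_deriv_poly_op[OF p x])
  show "gateaux_differentiable_at p (poly_op m a) x"
    using has_lp_frechet_deriv_imp_gateaux[OF p D] unfolding gateaux_differentiable_at_def by blast
  show "lp_frechet_differentiable_at p (poly_op m a) x"
    using D unfolding lp_frechet_differentiable_at_def by blast
  have deriv: "lp_frechet_deriv p (poly_op m a) x v = ?D v" if "v \<in> lp p" for v
    using lp_frechet_deriv_eq[OF p D that] .
  show "lp_represented_by p (lp_frechet_deriv p (poly_op m a) x)
      (diag_matrix (\<lambda>n. \<Sum>i = 1..m. real i * a i * x n ^ (i - 1)))"
    unfolding lp_represented_by_def
  proof (intro ballI allI)
    fix v n
    assume v: "v \<in> lp p"
    \<comment> \<open>Row \<open>n\<close> of the diagonal matrix contributes a single term to the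
      series.\<close>
    have "(\<lambda>k. if k = n then ?D v k else 0) sums ?D v n"
      by (rule sums_single)
    then show "(\<lambda>k. diag_matrix (\<lambda>n. \<Sum>i = 1..m. real i * a i * x n ^ (i - 1)) n k * v k) sums
        lp_frechet_deriv p (poly_op m a) x v n"
      unfolding deriv[OF v] by (rule back_subst[of "\<lambda>f. f sums _"]) (auto simp: diag_matrix_def)
  qed
  fix v
  assume v: "v \<in> lp p - {lp_zero}"
  show "gateaux_deriv p (poly_op m a) x v = lp_frechet_deriv p (poly_op m a) x v"
    using gateaux_deriv_eq[OF p D v] deriv v by simp
  \<comment> \<open>The same equation is required once for \<open>1 < m\<close> and once for
    \<open>m = 1\<close>.\<close>
  then show "gateaux_deriv p (poly_op m a) x v = lp_frechet_deriv p (poly_op m a) x v" .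
  show "lp_frechet_deriv p (poly_op m a) x v =
      (\<lambda>n. \<Sum>i = 1..m. real i * a i * x n ^ (i - 1) * v n)"
    using deriv v by (simp add: sum_distrib_right)
  show "(\<lambda>n. a 1 * v n) \<in> lp p"
    using lp_scale(1)[OF p] v by blast
  \<comment> \<open>Only \<open>i = 1\<close> remains, and \<open>x n ^ 0 = 1\<close> also where
    \<open>x n = 0\<close>.\<close>
  show "lp_frechet_deriv p (poly_op m a) x v = (\<lambda>n. a 1 * v n)" if "m = 1"
    using deriv v that by simp
qed

end
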